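(* Let $p>2$ be a prime, $n\ge1$ an integer, and let $M_1,\dots,M_n$ be symmetric $n\times n$ matrices over $\mathbb{F}_p$ such that every nonzero $\mathbb{F}_p$-linear combination of them has rank $n$. Let $Q_i(x)=x^TM_ix$ and $\mathrm{QGS}(p,n)=\{x\in\mathbb{F}_p^n : \exists i \text{ with } Q_1(x)=\dots=Q_{i-1}(x)=0,\ Q_i(x)=1\}$. Then the $\mathrm{VC}_2$-dimension of $\mathrm{QGS}(p,n)$ is at most $br(5;3,3)$.
   Context: For a finite abelian group $G$ and $A\subseteq G$, $A$ has $\mathrm{VC}_2$-dimension at least $k$ ($k\ge1$) if there exist elements $\{x_i: i\in[k]\}\cup\{y_i : i\in[k]\}\cup\{z_S : S\subseteq[k]^2\}$ of $G$ such that $x_i+y_j+z_S\in A$ if and only if $(i,j)\in S$; the $\mathrm{VC}_2$-dimension of $A$ is the largest such $k$. The bipartite $r$-colour Ramsey number $br(r;s,t)$ is the least integer $N$ such that every $r$-colouring of the edges of the complete bipartite graph $K_{N,N}$ contains a monochromatic copy of $K_{s,t}$. The matrices $M_1,\dots,M_n$ (the paper describes them as a basis of a space of symmetric matrices all of whose nonzero members have rank $n$; such exist for odd $n$) define the quadratic Green–Sanders example $\mathrm{QGS}(p,n)$. *)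

theory Defs
  imports "HOL-Analysis.Analysis" "Berlekamp_Zassenhaus.Finite_Field"
begin

text \<open>The abelian group is the whole (finite) type. The elements \<open>z\<^sub>S\<close> are indexed by the
  subsets of \<open>[k]\<^sup>2\<close>; values of \<open>x\<close>, \<open>y\<close>, \<open>z\<close> outside the index sets are irrelevant.\<close>

definition vc2_dim_at_least :: "'a::{ab_group_add,finite} set \<Rightarrow> nat \<Rightarrow> bool" where
  "vc2_dim_at_least A k \<longleftrightarrow>
    (\<exists>(x :: nat \<Rightarrow> 'a) (y :: nat \<Rightarrow> 'a) (z :: (nat \<times> nat) set \<Rightarrow> 'a).
      \<forall>S. S \<subseteq> {1..k} \<times> {1..k} \<longrightarrow>
        (\<forall>i\<in>{1..k}. \<forall>j\<in>{1..k}. x i + y j + z S \<in> A \<longleftrightarrow> (i, j) \<in> S))"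

text \<open>The set below is finite, since \<open>S \<mapsto> z\<^sub>S\<close> is injective. It always contains \<open>0\<close>, where the
  condition is vacuous, so the dimension is \<open>0\<close> if no \<open>k \<ge> 1\<close> is attained.\<close>

definition vc2_dim :: "'a::{ab_group_add,finite} set \<Rightarrow> nat" where
  "vc2_dim A = Max {k. vc2_dim_at_least A k}"

text \<open>The edges of \<open>K\<^sub>N\<^sub>,\<^sub>N\<close> are the pairs in \<open>[N] \<times> [N]\<close>. A copy of \<open>K\<^sub>s\<^sub>,\<^sub>t\<close> may have its part of
  size \<open>s\<close> on either side.\<close>

definition has_mono_biclique :: "(nat \<Rightarrow> nat \<Rightarrow> nat) \<Rightarrow> nat \<Rightarrow> nat \<Rightarrow> nat \<Rightarrow> bool" where
  "has_mono_biclique c N s t \<longleftrightarrow>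
    (\<exists>A B col. A \<subseteq> {1..N} \<and> B \<subseteq> {1..N} \<and>
      (card A = s \<and> card B = t \<or> card A = t \<and> card B = s) \<and>
      (\<forall>a\<in>A. \<forall>b\<in>B. c a b = col))"

definition bipartite_ramsey :: "nat \<Rightarrow> nat \<Rightarrow> nat \<Rightarrow> nat" where
  "bipartite_ramsey r s t =
    (LEAST N. \<forall>c :: nat \<Rightarrow> nat \<Rightarrow> nat.
      (\<forall>a\<in>{1..N}. \<forall>b\<in>{1..N}. c a b \<in> {1..r}) \<longrightarrow> has_mono_biclique c N s t)"

definition quad_form :: "'a::comm_semiring_1 ^ 'n ^ 'n \<Rightarrow> 'a ^ 'n \<Rightarrow> 'a" where
  "quad_form M x = scalar_product x (M *v x)"

text \<open>Here \<open>M\<close> is a sequence of matrices of which \<open>M 1, \<dots>, M n\<close> are used, \<open>n = CARD('n)\<close>.\<close>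

definition lin_comb :: "(nat \<Rightarrow> 'a::comm_semiring_1) \<Rightarrow> (nat \<Rightarrow> 'a ^ 'n ^ 'n) \<Rightarrow> 'a ^ 'n ^ 'n" where
  "lin_comb c M = (\<chi> a b. \<Sum>i = 1..CARD('n). c i * M i $ a $ b)"

definition QGS :: "(nat \<Rightarrow> 'a::comm_semiring_1 ^ 'n ^ 'n) \<Rightarrow> ('a ^ 'n) set" where
  "QGS M = {x. \<exists>i\<in>{1..CARD('n)}.
      (\<forall>j\<in>{1..<i}. quad_form (M j) x = 0) \<and> quad_form (M i) x = 1}"

end

theory Submission
  imports Defs
begin

text \<open>The value of the quadratic form \<open>Q\<^sub>l\<close> at \<open>x\<^sub>i + y\<^sub>j + z\<^sub>S\<close> is \<open>f\<^sub>S i + g\<^sub>S j + B\<^sub>l i j\<close>, where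
  \<open>B\<^sub>l\<close> does not depend on \<open>S\<close>. As long as the lower forms vanish on the whole grid, membership in
  \<open>QGS\<close> forces this value to be \<open>0\<close> or \<open>1\<close> for \<open>(i, j) \<in> S\<close> and different from \<open>1\<close> otherwise
  (\<open>admissible\<close> below). Since \<open>2 \<noteq> 0\<close>, sufficiently rich sets \<open>S\<close> allow no nonzero
  admissible function of the form \<open>f i + g j\<close>. On a \<open>50 \<times> 50\<close> grid, varying \<open>S\<close> over these rigid sets
  forces \<open>B\<^sub>l\<close> itself to be of that form, so that \<open>Q\<^sub>l\<close> vanishes on the grid for every rigid \<open>S\<close>. By
  induction all forms vanish there, so no point of the grid lies in \<open>QGS\<close>, although \<open>S\<close> is not empty.
  Hence the dimension is below \<open>50\<close>, while \<open>br(5;3,3) > 50\<close>.\<close>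

section \<open>The bipartite Ramsey number\<close>

lemma pigeonhole_card_fibre:
  assumes "finite A" "finite T" "f ` A \<subseteq> T" "card T * m < card A"
  obtains y where "y \<in> T" "m < card {x \<in> A. f x = y}"
proof (rule ccontr)
  assume "\<not> thesis"
  then have "\<forall>y\<in>T. card {x \<in> A. f x = y} \<le> m"
    using that not_less by blast
  then have "(\<Sum>y\<in>T. card {x \<in> A. f x = y}) \<le> card T * m"
    using sum_bounded_above[of T "\<lambda>y. card {x \<in> A. f x = y}" m] by simp
  moreover have "card A = (\<Sum>y\<in>T. card {x \<in> A. f x = y})"
    using sum.group[of A T f "\<lambda>_. 1 :: nat"] assms by simp
  ultimately show False
    using assms(4) by linarith
qed

text \<open>Guarantees that the \<open>LEAST\<close> in \<open>bipartite_ramsey\<close> is attained.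
  Double pigeonhole: more than \<open>s\<close> vertices \<open>b\<close> share one colour vector
  towards the first \<open>m\<close> vertices, and a vector of length \<open>r * s + 1\<close>
  repeats some colour more than \<open>s\<close> times.\<close>

lemma bipartite_ramsey_exists:
  "\<exists>N. \<forall>c. (\<forall>a\<in>{1..N}. \<forall>b\<in>{1..N}. c a b \<in> {1..r}) \<longrightarrow> has_mono_biclique c N s s"
proof -
  define m where "m = r * s + 1"
  define N where "N = r ^ m * s + m"
  have "m \<le> N"
    by (simp add: N_def)
  have "has_mono_biclique c N s s"
    if c: "\<forall>a\<in>{1..N}. \<forall>b\<in>{1..N}. c a b \<in> {1..r}" for c :: "nat \<Rightarrow> nat \<Rightarrow> nat"
  proof -
    define T :: "(nat \<Rightarrow> nat) set" where "T = {1..m} \<rightarrow>\<^sub>E {1..r}"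
    have T: "finite T" "card T = r ^ m"
      unfolding T_def by (simp_all add: finite_PiE card_PiE)
    have "(\<lambda>b. restrict (\<lambda>a. c a b) {1..m}) ` {1..N} \<subseteq> T"
      unfolding T_def using c \<open>m \<le> N\<close> by fastforce
    moreover have "card T * s < card {1..N}"
      by (simp add: T N_def m_def)
    ultimately obtain col where col: "s < card {b \<in> {1..N}. restrict (\<lambda>a. c a b) {1..m} = col}"
      using pigeonhole_card_fibre[of "{1..N}" T _ s] T(1) by blast
    then obtain B where B: "B \<subseteq> {b \<in> {1..N}. restrict (\<lambda>a. c a b) {1..m} = col}" "card B = s"
      by (meson less_imp_le obtain_subset_with_card_n)
    obtain b0 where b0: "b0 \<in> {1..N}" "restrict (\<lambda>a. c a b0) {1..m} = col"
      using col by (metis (mono_tags, lifting) card.empty empty_Collect_eq less_nat_zero_code)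
    have "col a \<in> {1..r}" if "a \<in> {1..m}" for a
      using b0 c \<open>m \<le> N\<close> that by auto
    then have "col ` {1..m} \<subseteq> {1..r}"
      by blast
    moreover have "card {1..r} * s < card {1..m}"
      by (simp add: m_def)
    ultimately obtain k where "s < card {a \<in> {1..m}. col a = k}"
      using pigeonhole_card_fibre[of "{1..m}" "{1..r}" col s] by blast
    then obtain A where A: "A \<subseteq> {a \<in> {1..m}. col a = k}" "card A = s"
      by (meson less_imp_le obtain_subset_with_card_n)
    have "c a b = k" if "a \<in> A" "b \<in> B" for a b
    proof -
      have "restrict (\<lambda>a. c a b) {1..m} a = col a"
        using B(1) that(2) by blast
      then show ?thesis
        using A(1) that(1) by auto
    qed
    then have "\<forall>a\<in>A. \<forall>b\<in>B. c a b = k"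
      by blast
    moreover have "A \<subseteq> {1..N}" "B \<subseteq> {1..N}"
      using A(1) B(1) \<open>m \<le> N\<close> by auto
    ultimately show ?thesis
      unfolding has_mono_biclique_def using A(2) B(2)
      by (intro exI[of _ A] exI[of _ B] exI[of _ k]) simp
  qed
  then show ?thesis
    by blast
qed

text \<open>With \<open>i = 5 a + b\<close> and \<open>j = 5 c + d\<close>, each colour class is the incidence graph \<open>d = const - b - a c\<close>
  of points and lines over \<open>\<int>/5\<close>, hence \<open>K\<^sub>2\<^sub>,\<^sub>2\<close>-free. Doubling every vertex then leaves it
  \<open>K\<^sub>3\<^sub>,\<^sub>3\<close>-free.\<close>

definition incidence_colour :: "nat \<Rightarrow> nat \<Rightarrow> nat" where
  "incidence_colour i j = ((i mod 5) + (j mod 5) + (i div 5) * (j div 5)) mod 5"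

lemma incidence_colour_less: "incidence_colour i j < 5"
  unfolding incidence_colour_def by (rule mod_less_divisor) simp

lemma int_incidence_colour:
  "int (incidence_colour i j)
    = (int (i mod 5) + int (j mod 5) + int (i div 5) * int (j div 5)) mod 5"
  by (simp only: incidence_colour_def of_nat_mod of_nat_add of_nat_mult of_nat_numeral)

text \<open>The alternating sum of the four congruences cancels the remainders and leaves
  \<open>(a - a') * (c - c')\<close> divisible by the prime 5. All quotients are below 5, so one
  factor vanishes, and one more congruence identifies the corresponding remainders.\<close>

lemma incidence_colour_no_rectangle:
  assumes "i < 25" "i' < 25" "j < 25" "j' < 25"
    and "incidence_colour i j = k" "incidence_colour i j' = k"
    and "incidence_colour i' j = k" "incidence_colour i' j' = k"
  shows "i = i' \<or> j = j'"
proof -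
  define a b a' b' where ab: "a = int (i div 5)" "b = int (i mod 5)" "a' = int (i' div 5)" "b' = int (i' mod 5)"
  define c d c' d' where cd: "c = int (j div 5)" "d = int (j mod 5)" "c' = int (j' div 5)" "d' = int (j' mod 5)"
  have bounds: "0 \<le> a" "a < 5" "0 \<le> b" "b < 5" "0 \<le> a'" "a' < 5" "0 \<le> b'" "b' < 5"
    "0 \<le> c" "c < 5" "0 \<le> d" "d < 5" "0 \<le> c'" "c' < 5" "0 \<le> d'" "d' < 5"
    using assms(1-4) unfolding ab cd by (auto simp: zdiv_int)
  have col: "(b + d + a * c) mod 5 = int k" "(b + d' + a * c') mod 5 = int k"
    "(b' + d + a' * c) mod 5 = int k" "(b' + d' + a' * c') mod 5 = int k"
    using assms(5-8) unfolding ab cd by (simp_all only: int_incidence_colour[symmetric])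
  have 1: "5 dvd (b + d + a * c) - (b + d' + a * c')"
    by (rule mod_eq_dvd_iff[THEN iffD1]) (simp only: col)
  have 2: "5 dvd (b' + d + a' * c) - (b' + d' + a' * c')"
    by (rule mod_eq_dvd_iff[THEN iffD1]) (simp only: col)
  have 3: "5 dvd (b + d + a * c) - (b' + d + a' * c)"
    by (rule mod_eq_dvd_iff[THEN iffD1]) (simp only: col)
  have "5 dvd ((b + d + a * c) - (b + d' + a * c')) - ((b' + d + a' * c) - (b' + d' + a' * c'))"
    using 1 2 by (rule dvd_diff)
  also have "\<dots> = (a - a') * (c - c')"
    by (simp add: algebra_simps)
  finally have "5 dvd a - a' \<or> 5 dvd c - c'"
    by (subst (asm) prime_dvd_mult_iff) auto
  moreover have eqI: "x = y" if "5 dvd x - y" "0 \<le> x" "x < 5" "0 \<le> y" "y < 5" for x y :: int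
    using that by (metis mod_eq_dvd_iff mod_pos_pos_trivial)
  ultimately have "a = a' \<or> c = c'"
    using bounds by blast
  then show ?thesis
  proof
    assume "a = a'"
    moreover from this 3 have "b = b'"
      using eqI[of b b'] bounds by simp
    ultimately show ?thesis
      unfolding ab by (metis div_mult_mod_eq of_nat_eq_iff)
  next
    assume "c = c'"
    moreover from this 1 have "d = d'"
      using eqI[of d d'] bounds by simp
    ultimately show ?thesis
      unfolding cd by (metis div_mult_mod_eq of_nat_eq_iff)
  qed
qed

text \<open>A fibre of \<open>div 2\<close> has two elements, so three vertices of the doubled graph
  lie over at least two original ones.\<close>

lemma card_3_two_halves:
  assumes "card A = 3"
  obtains i i' :: nat where "i \<in> A" "i' \<in> A" "i div 2 \<noteq> i' div 2"
proof (rule ccontr)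
  assume "\<not> thesis"
  with that have *: "\<forall>i\<in>A. \<forall>i'\<in>A. i div 2 = i' div 2"
    by blast
  obtain i0 where i0: "i0 \<in> A"
    using assms by fastforce
  have "A \<subseteq> {2 * (i0 div 2), 2 * (i0 div 2) + 1}"
  proof
    fix i assume "i \<in> A"
    then have "i div 2 = i0 div 2"
      using * i0 by blast
    then show "i \<in> {2 * (i0 div 2), 2 * (i0 div 2) + 1}"
      by auto
  qed
  then have "card A \<le> 2"
    by (metis card_2_iff card_mono finite.emptyI finite.insertI n_not_Suc_n Suc_eq_plus1)
  with assms show False
    by simp
qed

lemma bipartite_ramsey_5_3_3_gt: "50 < bipartite_ramsey 5 3 3"
proof (rule ccontr)
  define N where "N = bipartite_ramsey 5 3 3"
  assume "\<not> 50 < bipartite_ramsey 5 3 3"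
  then have N: "N \<le> 50"
    by (simp add: N_def)
  \<comment> \<open>The 25 vertices on each side are doubled. The shifts by one reconcile vertices
    numbered from 1 and colours 1 to 5 with the zero-based \<open>incidence_colour\<close>.\<close>
  define c where "c i j = incidence_colour ((i - 1) div 2) ((j - 1) div 2) + 1" for i j :: nat
  have "\<forall>c. (\<forall>a\<in>{1..N}. \<forall>b\<in>{1..N}. c a b \<in> {1..5}) \<longrightarrow> has_mono_biclique c N 3 3"
    unfolding N_def bipartite_ramsey_def by (rule LeastI_ex[OF bipartite_ramsey_exists])
  moreover have "\<forall>a\<in>{1..N}. \<forall>b\<in>{1..N}. c a b \<in> {1..5}"
    using incidence_colour_less by (auto simp: c_def Suc_le_eq)
  ultimately have "has_mono_biclique c N 3 3"
    by blast
  then obtain A B k where AB: "A \<subseteq> {1..N}" "B \<subseteq> {1..N}" "card A = 3" "card B = 3"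
    and k: "\<forall>a\<in>A. \<forall>b\<in>B. c a b = k"
    unfolding has_mono_biclique_def by blast
  have shift: "card ((\<lambda>i. i - 1) ` X) = 3" if "X \<subseteq> {1..N}" "card X = 3" for X
    using that by (subst card_image) (auto intro!: inj_on_diff_nat)
  obtain i i' where i: "i \<in> A" "i' \<in> A" "(i - 1) div 2 \<noteq> (i' - 1) div 2"
    using card_3_two_halves[OF shift[OF AB(1,3)]] by blast
  obtain j j' where j: "j \<in> B" "j' \<in> B" "(j - 1) div 2 \<noteq> (j' - 1) div 2"
    using card_3_two_halves[OF shift[OF AB(2,4)]] by blast
  have small: "(x - 1) div 2 < 25" if "x \<in> A \<or> x \<in> B" for x
    using AB(1,2) that N by force
  have "incidence_colour ((x - 1) div 2) ((y - 1) div 2) = k - 1" if "x \<in> A" "y \<in> B" for x y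
    using k that unfolding c_def by fastforce
  then show False
    using incidence_colour_no_rectangle[of "(i - 1) div 2" "(i' - 1) div 2" "(j - 1) div 2" "(j' - 1) div 2" "k - 1"]
      small i j by blast
qed

section \<open>Admissible matrices\<close>

definition admissible :: "bool \<Rightarrow> 'f::{zero_neq_one} \<Rightarrow> bool" where
  "admissible P x \<longleftrightarrow> (if P then x = 0 \<or> x = 1 else x \<noteq> 1)"

lemma admissible_both: "admissible True x \<Longrightarrow> admissible False x \<Longrightarrow> x = 0"
  by (auto simp: admissible_def)

text \<open>The traces that a row may leave on the three test columns. Without the empty trace,
  every pattern but the full one both meets and misses a test column, which forces a value constant
  on these columns to be 0.\<close>

definition patterns :: "nat set set" where
  "patterns = Pow {1, 2, 3} - {{}}"

lemma card_patterns: "finite patterns" "card patterns = 7"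
proof -
  show "finite patterns"
    by (simp add: patterns_def)
  have "card (Pow {1, 2, 3::nat}) = 8"
    by (subst card_Pow) auto
  then show "card patterns = 7"
    unfolding patterns_def by (subst card_Diff_subset) auto
qed

lemma patterns_mem:
  "{1} \<in> patterns" "{2} \<in> patterns" "{3} \<in> patterns"
  "{1, 2} \<in> patterns" "{1, 3} \<in> patterns" "{2, 3} \<in> patterns" "{1, 2, 3} \<in> patterns"
  by (auto simp: patterns_def)

lemma pattern_split:
  assumes "s \<in> patterns" "s \<noteq> {1, 2, 3}"
  obtains c c' where "c \<in> {1, 2, 3}" "c' \<in> {1, 2, 3}" "c \<in> s" "c' \<notin> s"
  using assms unfolding patterns_def by blast

text \<open>The full pattern allows a shift \<open>w\<close> of \<open>b\<close> with values 0 and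
  1. If \<open>w\<close> is not constant, two of its values agree and one differs. A pattern that
  separates the equal pair forces their shifted value to be 0. The third value is then 1 if the pair
  has \<open>w = 0\<close>, and the pattern omits it; or -1 if the pair has \<open>w = 1\<close>,
  and the pattern contains it. Neither is admissible, as \<open>2 \<noteq> 0\<close>.\<close>

lemma shattered_imp_constant:
  fixes b :: "nat \<Rightarrow> 'f::idom"
  assumes two: "(2 :: 'f) \<noteq> 0"
    and adm: "\<And>s. s \<in> patterns \<Longrightarrow> \<exists>u. \<forall>c\<in>{1, 2, 3}. admissible (c \<in> s) (u + b c)"
  shows "b 2 = b 1" "b 3 = b 1"
proof -
  have two': "(1 :: 'f) + 1 \<noteq> 0" "(1 :: 'f) + 1 \<noteq> 1"
    using two by simp (simp only: add_cancel_left_right one_neq_zero not_False_eq_True)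
  obtain u where u: "\<forall>c\<in>{1, 2, 3}. admissible (c \<in> {1, 2, 3::nat}) (u + b c)"
    using adm[OF patterns_mem(7)] by blast
  define w where "w c = u + b c" for c
  have w: "w c = 0 \<or> w c = 1" if "c \<in> {1, 2, 3}" for c
    using u that unfolding w_def admissible_def by auto
  have adm_w: "\<exists>v. admissible (1 \<in> s) (v + w 1) \<and> admissible (2 \<in> s) (v + w 2)
      \<and> admissible (3 \<in> s) (v + w 3)" if s: "s \<in> patterns" for s
  proof -
    obtain v where "\<forall>c\<in>{1, 2, 3}. admissible (c \<in> s) (v + b c)"
      using adm[OF s] by blast
    then show ?thesis
      by (intro exI[of _ "v - u"]) (auto simp: w_def)
  qed
  have 1: False if "admissible True v" "admissible True (v + 1)" "admissible False (v + 1)" for v :: 'f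
    using that two' unfolding admissible_def by auto
  have 2: False if "admissible True v" "admissible False v" "admissible False (v + 1)" for v :: 'f
    using that two' unfolding admissible_def by auto
  have "w 2 = w 1 \<and> w 3 = w 1"
  proof -
    have "\<not> (w 1 = 0 \<and> w 2 = 1 \<and> w 3 = 1)" using adm_w[OF patterns_mem(4)] 1 by auto
    moreover have "\<not> (w 1 = 1 \<and> w 2 = 0 \<and> w 3 = 1)" using adm_w[OF patterns_mem(4)] 1 by auto
    moreover have "\<not> (w 1 = 1 \<and> w 2 = 1 \<and> w 3 = 0)" using adm_w[OF patterns_mem(5)] 1 by auto
    moreover have "\<not> (w 1 = 1 \<and> w 2 = 0 \<and> w 3 = 0)" using adm_w[OF patterns_mem(2)] 2 by auto
    moreover have "\<not> (w 1 = 0 \<and> w 2 = 1 \<and> w 3 = 0)" using adm_w[OF patterns_mem(1)] 2 by auto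
    moreover have "\<not> (w 1 = 0 \<and> w 2 = 0 \<and> w 3 = 1)" using adm_w[OF patterns_mem(1)] 2 by auto
    ultimately show ?thesis
      using w[of 1] w[of 2] w[of 3] by auto
  qed
  then show "b 2 = b 1" "b 3 = b 1"
    by (auto simp: w_def)
qed

section \<open>Rigid patterns\<close>

text \<open>The rows \<open>\<rho> s\<close> witness that \<open>S\<close> shatters the columns 1,
  2, 3, up to the empty trace.\<close>

definition core :: "(nat set \<Rightarrow> nat) \<Rightarrow> (nat \<times> nat) set \<Rightarrow> bool" where
  "core \<rho> S \<longleftrightarrow> (\<forall>s\<in>patterns. \<rho> s \<in> {1..50} \<and> (\<forall>c\<in>{1, 2, 3}. (\<rho> s, c) \<in> S \<longleftrightarrow> c \<in> s))"

text \<open>Each clause extends the vanishing of an admissible \<open>f i + g j\<close>: the core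
  settles the test columns in the rows of non-full pattern, the second clause carries this to the
  other columns, the third to all rows.\<close>

definition rigid :: "(nat \<times> nat) set \<Rightarrow> bool" where
  "rigid S \<longleftrightarrow> (\<exists>\<rho>. core \<rho> S \<and>
    (\<forall>j\<in>{4..50}. \<exists>s\<in>patterns - {{1, 2, 3}}. \<exists>s'\<in>patterns - {{1, 2, 3}}. (\<rho> s, j) \<in> S \<and> (\<rho> s', j) \<notin> S) \<and>
    (\<forall>i\<in>{1..50}. \<exists>j\<in>{1..50}. \<exists>j'\<in>{1..50}. (i, j) \<in> S \<and> (i, j') \<notin> S))"

text \<open>In row \<open>\<rho> s\<close> the term \<open>f (\<rho> s)\<close> acts as the free
  shift of \<open>shattered_imp_constant\<close>, so \<open>g\<close> is constant on the test
  columns. A row of non-full pattern then has the same value inside and outside \<open>S\<close>,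
  hence 0.\<close>

lemma core_additive:
  fixes f g :: "nat \<Rightarrow> 'f::idom"
  assumes two: "(2 :: 'f) \<noteq> 0" and core: "core \<rho> S"
    and adm: "\<And>s c. s \<in> patterns \<Longrightarrow> c \<in> {1, 2, 3} \<Longrightarrow> admissible ((\<rho> s, c) \<in> S) (f (\<rho> s) + g c)"
  shows "\<And>c. c \<in> {1, 2, 3} \<Longrightarrow> g c = g 1"
    and "\<And>s. s \<in> patterns \<Longrightarrow> s \<noteq> {1, 2, 3} \<Longrightarrow> f (\<rho> s) + g 1 = 0"
proof -
  have adm': "admissible (c \<in> s) (f (\<rho> s) + g c)" if "s \<in> patterns" "c \<in> {1, 2, 3}" for s c
  proof -
    have "(\<rho> s, c) \<in> S \<longleftrightarrow> c \<in> s"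
      using core that unfolding core_def by blast
    then show ?thesis
      using adm[OF that] by (simp only:)
  qed
  then have "g 2 = g 1" "g 3 = g 1"
    using shattered_imp_constant[OF two, of g] by blast+
  then show g: "\<And>c. c \<in> {1, 2, 3} \<Longrightarrow> g c = g 1"
    by auto
  fix s assume s: "s \<in> patterns" "s \<noteq> {1, 2, 3}"
  then obtain c c' where "c \<in> {1, 2, 3}" "c' \<in> {1, 2, 3}" "c \<in> s" "c' \<notin> s"
    by (rule pattern_split)
  then have "admissible True (f (\<rho> s) + g 1)" "admissible False (f (\<rho> s) + g 1)"
    using adm'[OF s(1), of c] adm'[OF s(1), of c'] g[of c] g[of c'] by simp_all
  then show "f (\<rho> s) + g 1 = 0"
    by (rule admissible_both)
qed

lemma rigid_additive_zero:
  fixes f g :: "nat \<Rightarrow> 'f::idom"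
  assumes two: "(2 :: 'f) \<noteq> 0" and "rigid S"
    and adm: "\<And>i j. i \<in> {1..50} \<Longrightarrow> j \<in> {1..50} \<Longrightarrow> admissible ((i, j) \<in> S) (f i + g j)"
    and ij: "i \<in> {1..50}" "j \<in> {1..50}"
  shows "f i + g j = 0"
proof -
  obtain \<rho> where \<rho>: "core \<rho> S"
    and cols: "\<And>j. j \<in> {4..50} \<Longrightarrow> \<exists>s\<in>patterns - {{1, 2, 3}}. \<exists>s'\<in>patterns - {{1, 2, 3}}. (\<rho> s, j) \<in> S \<and> (\<rho> s', j) \<notin> S"
    and rows: "\<And>i. i \<in> {1..50} \<Longrightarrow> \<exists>j\<in>{1..50}. \<exists>j'\<in>{1..50}. (i, j) \<in> S \<and> (i, j') \<notin> S"
    using \<open>rigid S\<close> unfolding rigid_def by blast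
  have \<rho>_in: "\<rho> s \<in> {1..50}" if "s \<in> patterns" for s
    using \<rho> that unfolding core_def by blast
  have adm_core: "admissible ((\<rho> s, c) \<in> S) (f (\<rho> s) + g c)" if "s \<in> patterns" "c \<in> {1, 2, 3}" for s c
    using adm[of "\<rho> s" c] \<rho>_in[OF that(1)] that(2) by force
  have core: "\<And>c. c \<in> {1, 2, 3} \<Longrightarrow> g c = g 1"
    "\<And>s. s \<in> patterns \<Longrightarrow> s \<noteq> {1, 2, 3} \<Longrightarrow> f (\<rho> s) + g 1 = 0"
    using core_additive[OF two \<rho>, of f g] adm_core by blast+
  have g: "g j = g 1" if j: "j \<in> {1..50}" for j
  proof (cases "j \<in> {1, 2, 3}")
    case True
    then show ?thesis by (rule core(1))
  next
    case False
    with j have "j \<in> {4..50}"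
      by auto
    from cols[OF this] obtain s s' where s: "s \<in> patterns" "s \<noteq> {1, 2, 3}"
      "s' \<in> patterns" "s' \<noteq> {1, 2, 3}" "(\<rho> s, j) \<in> S" "(\<rho> s', j) \<notin> S"
      by blast
    \<comment> \<open>Both sides equal \<open>- g 1\<close>, so column \<open>j\<close> shows one
      common value both inside and outside \<open>S\<close>.\<close>
    have eq: "f (\<rho> s) = f (\<rho> s')"
      using core(2)[OF s(1,2)] core(2)[OF s(3,4)] add_right_imp_eq by metis
    have "admissible True (f (\<rho> s) + g j)"
      using adm[OF \<rho>_in[OF s(1)] j] s(5) by simp
    moreover have "admissible False (f (\<rho> s) + g j)"
      using adm[OF \<rho>_in[OF s(3)] j] s(6) eq by simp
    ultimately have "f (\<rho> s) + g j = 0"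
      by (rule admissible_both)
    then show ?thesis
      using core(2)[OF s(1,2)] add_left_imp_eq by metis
  qed
  obtain a a' where "a \<in> {1..50}" "a' \<in> {1..50}" "(i, a) \<in> S" "(i, a') \<notin> S"
    using rows[OF ij(1)] by blast
  then have "admissible True (f i + g 1)" "admissible False (f i + g 1)"
    using adm[OF ij(1), of a] adm[OF ij(1), of a'] g[of a] g[of a'] by simp_all
  then have "f i + g 1 = 0"
    by (rule admissible_both)
  then show ?thesis
    using g[OF ij(2)] by simp
qed

text \<open>Supplies rigid sets with a chosen core whose other entries in the test columns, and
  whose entire column \<open>j\<close>, are dictated by \<open>P\<close>. The conditions on
  \<open>P\<close> make column \<open>j\<close> separate two core rows.\<close>

lemma rigid_set_exists:
  assumes inj: "inj_on \<rho> patterns" and \<rho>_in: "\<rho> ` patterns \<subseteq> {1..50}"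
    and j: "j \<in> {4..50}"
    and P: "P (\<rho> {1}) j" "\<not> P (\<rho> {2}) j"
  shows "\<exists>S. S \<subseteq> {1..50} \<times> {1..50} \<and> rigid S \<and> core \<rho> S \<and>
    (\<forall>i\<in>{1..50} - \<rho> ` patterns. \<forall>c\<in>{1, 2, 3}. (i, c) \<in> S \<longleftrightarrow> P i c) \<and>
    (\<forall>i\<in>{1..50}. (i, j) \<in> S \<longleftrightarrow> P i j)"
proof -
  \<comment> \<open>In the remaining columns, row \<open>\<rho> {1}\<close> takes the even ones and
    every other row the odd ones. Each such column thus separates \<open>\<rho> {1}\<close> from
    \<open>\<rho> {2}\<close>, and each row both meets and misses \<open>S\<close>.\<close>
  define S where "S = {(i, c). i \<in> {1..50} \<and> c \<in> {1..50::nat} \<and>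
    (if c \<le> 3 then (if i \<in> \<rho> ` patterns then \<exists>t\<in>patterns. i = \<rho> t \<and> c \<in> t else P i c)
     else if c = j then P i c else (i = \<rho> {1}) = even c)}"
  have S: "S \<subseteq> {1..50} \<times> {1..50}"
    unfolding S_def by blast
  have mem: "(i, c) \<in> S \<longleftrightarrow>
      (if c \<le> 3 then (if i \<in> \<rho> ` patterns then \<exists>t\<in>patterns. i = \<rho> t \<and> c \<in> t else P i c)
       else if c = j then P i c else (i = \<rho> {1}) = even c)"
    if "i \<in> {1..50}" "c \<in> {1..50}" for i c
    unfolding S_def using that by blast
  have left: "(i, c) \<in> S \<longleftrightarrow> P i c" if "i \<in> {1..50} - \<rho> ` patterns" "c \<in> {1, 2, 3}" for i c
  proof -
    have "c \<in> {1..50}" "c \<le> 3"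
      using that(2) by auto
    then show ?thesis
      using mem[of i c] that(1) by (simp only: if_True if_False Diff_iff)
  qed
  have col: "(i, j) \<in> S \<longleftrightarrow> P i j" if "i \<in> {1..50}" for i
  proof -
    have "j \<in> {1..50}" "\<not> j \<le> 3"
      using j by auto
    then show ?thesis
      using mem[OF that, of j] by (simp only: if_False if_True refl)
  qed
  have rest: "(i, c) \<in> S \<longleftrightarrow> (i = \<rho> {1}) = even c" if "i \<in> {1..50}" "c \<in> {4..50}" "c \<noteq> j" for i c
  proof -
    have "c \<in> {1..50}" "\<not> c \<le> 3"
      using that(2) by auto
    then show ?thesis
      using mem[OF that(1), of c] that(3) by (simp only: if_False)
  qed
  have core: "core \<rho> S"
    unfolding core_def
  proof (intro ballI conjI)
    fix t assume t: "t \<in> patterns"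
    then show "\<rho> t \<in> {1..50}"
      using \<rho>_in by blast
    fix c :: nat assume "c \<in> {1, 2, 3}"
    then have c: "c \<in> {1..50}" "c \<le> 3"
      by auto
    have "(\<exists>t'\<in>patterns. \<rho> t = \<rho> t' \<and> c \<in> t') \<longleftrightarrow> c \<in> t"
      using t inj by (metis inj_onD)
    then show "(\<rho> t, c) \<in> S \<longleftrightarrow> c \<in> t"
      using mem[OF \<open>\<rho> t \<in> {1..50}\<close> c(1)] c(2) t by (simp only: if_True imageI)
  qed
  have cols: "\<exists>t\<in>patterns - {{1, 2, 3}}. \<exists>t'\<in>patterns - {{1, 2, 3}}. (\<rho> t, c) \<in> S \<and> (\<rho> t', c) \<notin> S"
    if c: "c \<in> {4..50}" for c
  proof (cases "c = j")
    case True
    have "\<rho> {1} \<in> {1..50}" "\<rho> {2} \<in> {1..50}"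
      using \<rho>_in patterns_mem(1,2) by blast+
    then have "(\<rho> {1}, j) \<in> S" "(\<rho> {2}, j) \<notin> S"
      using P col by simp_all
    moreover have "{1} \<in> patterns - {{1, 2, 3}}" "{2} \<in> patterns - {{1, 2, 3}}"
      using patterns_mem(1,2) by auto
    ultimately show ?thesis
      using True by blast
  next
    case False
    have "\<rho> {1} \<noteq> \<rho> {2}"
      using inj_onD[OF inj _ patterns_mem(1,2)] by auto
    moreover have "{1} \<in> patterns - {{1, 2, 3}}" "{2} \<in> patterns - {{1, 2, 3}}"
      using patterns_mem(1,2) by auto
    moreover have "\<rho> {1} \<in> {1..50}" "\<rho> {2} \<in> {1..50}"
      using \<rho>_in by (meson image_subset_iff patterns_mem)+
    moreover from this have "(\<rho> {1}, c) \<in> S \<longleftrightarrow> even c" "(\<rho> {2}, c) \<in> S \<longleftrightarrow> odd c"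
      using rest[OF _ c False] \<open>\<rho> {1} \<noteq> \<rho> {2}\<close> by simp_all
    ultimately show ?thesis
      by (cases "even c") (metis (no_types))+
  qed
  have rows: "\<exists>a\<in>{1..50}. \<exists>a'\<in>{1..50}. (i, a) \<in> S \<and> (i, a') \<notin> S" if i: "i \<in> {1..50}" for i
  proof -
    obtain a where a: "a \<in> {4..50}" "a \<noteq> j" "even a"
      by (cases "j = 4") (auto intro: that[of 4] that[of 6])
    obtain a' where a': "a' \<in> {4..50}" "a' \<noteq> j" "odd a'"
      by (cases "j = 5") (auto intro: that[of 5] that[of 7])
    have "a \<in> {1..50}" "a' \<in> {1..50}"
      using a a' by auto
    moreover have "(i, a) \<in> S \<longleftrightarrow> i = \<rho> {1}" "(i, a') \<in> S \<longleftrightarrow> i \<noteq> \<rho> {1}"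
      using rest[OF i a(1,2)] rest[OF i a'(1,2)] a(3) a'(3) by simp_all
    ultimately show ?thesis
      by (cases "i = \<rho> {1}") (metis (no_types))+
  qed
  have "rigid S"
    unfolding rigid_def using core cols rows by blast
  then show ?thesis
    using S core left col by (intro exI[of _ S]) simp
qed

lemma patterns_bij:
  assumes "card R = 7"
  obtains \<rho> where "inj_on \<rho> patterns" "\<rho> ` patterns = (R :: nat set)"
proof -
  have "finite R"
    using assms card_ge_0_finite by force
  then obtain \<rho> where "bij_betw \<rho> patterns R"
    using finite_same_card_bij[OF card_patterns(1)] card_patterns(2) assms by metis
  then show ?thesis
    using that unfolding bij_betw_def by blast
qed

section \<open>Rigidly admissible matrices are sums of a row and a column function\<close>

text \<open>What the shattering says about the cross term of a form once the lower forms vanish: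
  \<open>B\<close> is fixed, while \<open>f\<close> and \<open>g\<close> may change with
  \<open>S\<close>.\<close>

definition rigidly_admissible :: "(nat \<Rightarrow> nat \<Rightarrow> 'f::idom) \<Rightarrow> bool" where
  "rigidly_admissible B \<longleftrightarrow> (\<forall>S. S \<subseteq> {1..50} \<times> {1..50} \<longrightarrow> rigid S \<longrightarrow>
    (\<exists>f g. \<forall>i\<in>{1..50}. \<forall>j\<in>{1..50}. admissible ((i, j) \<in> S) (f i + g j + B i j)))"

text \<open>If \<open>S\<close> contains \<open>{1..43} \<times> {1, 2, 3}\<close>, then \<open>f i + g j + B i j\<close> is \<open>0\<close>-\<open>1\<close>-valued there, so up to
  a constant each of its rows is one of seven, and \<open>43 > 6 \<cdot> 7\<close>. The rows \<open>44, \<dots>, 50\<close> make \<open>S\<close> rigid.\<close>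

lemma equal_rows:
  fixes B :: "nat \<Rightarrow> nat \<Rightarrow> 'f::idom"
  assumes B: "rigidly_admissible B"
  obtains R d where "R \<subseteq> {1..50}" "card R = 7"
    "\<And>i c. i \<in> R \<Longrightarrow> c \<in> {1, 2, 3} \<Longrightarrow> B i c = B i 1 + d c"
proof -
  obtain \<rho> where \<rho>: "inj_on \<rho> patterns" "\<rho> ` patterns = {44..50::nat}"
    by (rule patterns_bij[of "{44..50}"]) auto
  \<comment> \<open>All entries in the test columns outside the core are put into \<open>S\<close>;
    column 4 only serves to separate two core rows.\<close>
  define P where "P i c \<longleftrightarrow> c = 4 \<longrightarrow> i = \<rho> {1}" for i c :: nat
  have "\<rho> ` patterns \<subseteq> {1..50}" "4 \<in> {4..50::nat}"
    using \<rho>(2) by auto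
  moreover have "P (\<rho> {1}) 4" "\<not> P (\<rho> {2}) 4"
    using inj_onD[OF \<rho>(1) _ patterns_mem(1,2)] by (auto simp: P_def)
  ultimately obtain S where S: "S \<subseteq> {1..50} \<times> {1..50}" "rigid S"
    and PS: "\<And>i c. i \<in> {1..50} - \<rho> ` patterns \<Longrightarrow> c \<in> {1, 2, 3} \<Longrightarrow> (i, c) \<in> S \<longleftrightarrow> P i c"
    using rigid_set_exists[OF \<rho>(1), of _ P] by metis
  then obtain f g where fg: "\<And>i j. i \<in> {1..50} \<Longrightarrow> j \<in> {1..50} \<Longrightarrow> admissible ((i, j) \<in> S) (f i + g j + B i j)"
    using B unfolding rigidly_admissible_def by metis
  define u where "u i c = f i + g c + B i c" for i c
  have u: "u i c = 0 \<or> u i c = 1" if "i \<in> {1..43}" "c \<in> {1, 2, 3}" for i c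
  proof -
    have "(i, c) \<in> S"
      using PS[of i c] that \<rho>(2) by (auto simp: P_def)
    then show ?thesis
      using fg[of i c] that by (auto simp: u_def admissible_def)
  qed
  define h where "h i = (u i 2 - u i 1, u i 3 - u i 1)" for i
  \<comment> \<open>The differences to the first entry of the eight 0-1 triples; both constant
    triples give \<open>(0, 0)\<close>.\<close>
  define T :: "('f \<times> 'f) set" where "T = set [(0, 0), (0, 1), (1, 0), (1, 1), (-1, -1), (-1, 0), (0, -1)]"
  have "card T \<le> 7"
    unfolding T_def by (rule order_trans[OF card_length]) simp
  then have "card T * 6 < card {1..43::nat}"
    by simp
  moreover have "h ` {1..43} \<subseteq> T"
  proof
    fix t assume "t \<in> h ` {1..43}"
    then obtain i where i: "i \<in> {1..43}" "t = h i"
      by blast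
    have "u i 1 = 0 \<or> u i 1 = 1" "u i 2 = 0 \<or> u i 2 = 1" "u i 3 = 0 \<or> u i 3 = 1"
      by (rule u[OF i(1)], simp)+
    then show "t \<in> T"
      by (elim disjE) (simp_all add: i(2) h_def T_def)
  qed
  ultimately obtain t where "6 < card {i \<in> {1..43}. h i = t}"
    using pigeonhole_card_fibre[of "{1..43}" T h 6] unfolding T_def by blast
  then have "7 \<le> card {i \<in> {1..43}. h i = t}"
    by simp
  then obtain R where R: "R \<subseteq> {i \<in> {1..43}. h i = t}" "card R = 7"
    by (meson obtain_subset_with_card_n)
  \<comment> \<open>Solves \<open>u i c - u i 1\<close> for \<open>B i c - B i 1\<close>, which
    involves only \<open>t\<close> and \<open>g\<close> and hence is the same for all rows in
    \<open>R\<close>.\<close>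
  define d where "d c = (if c = 1 then 0 else if c = 2 then fst t + g 1 - g 2 else snd t + g 1 - g 3)" for c :: nat
  show ?thesis
  proof
    show "R \<subseteq> {1..50}" "card R = 7"
      using R by auto
    fix i c :: nat assume "i \<in> R" "c \<in> {1, 2, 3}"
    moreover have "h i = t"
      using \<open>i \<in> R\<close> R(1) by blast
    then have "fst t = u i 2 - u i 1" "snd t = u i 3 - u i 1"
      by (auto simp: h_def)
    ultimately show "B i c = B i 1 + d c"
      by (elim insertE emptyE) (simp_all add: d_def u_def algebra_simps)
  qed
qed

text \<open>With the equal rows \<open>R\<close> as core, \<open>B\<close> is absorbed there into
  the row and column terms, so \<open>g c + d c\<close> is constant on the test columns for each set
  \<open>S\<close> in play. The trace of row \<open>i\<close> outside \<open>R\<close> can still be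
  any pattern, hence \<open>B i c - d c\<close> is shattered and therefore constant.\<close>

lemma equal_rows_extend:
  fixes B :: "nat \<Rightarrow> nat \<Rightarrow> 'f::idom"
  assumes two: "(2 :: 'f) \<noteq> 0" and B: "rigidly_admissible B"
    and R: "R \<subseteq> {1..50}" "card R = 7"
    and d: "\<And>i c. i \<in> R \<Longrightarrow> c \<in> {1, 2, 3} \<Longrightarrow> B i c = B i 1 + d c"
    and i: "i \<in> {1..50}" and c: "c \<in> {1, 2, 3}"
  shows "B i c = B i 1 + d c"
proof (cases "i \<in> R")
  case True
  then show ?thesis
    using c by (rule d)
next
  case False
  obtain \<rho> where \<rho>: "inj_on \<rho> patterns" "\<rho> ` patterns = R"
    by (rule patterns_bij[OF R(2)])
  have \<rho>_in: "\<rho> s \<in> R" if "s \<in> patterns" for s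
    using that \<rho>(2) by blast
  have d1: "d 1 = 0"
    using d[OF \<rho>_in[OF patterns_mem(1)], of 1] by simp
  have "\<exists>v. \<forall>c\<in>{1, 2, 3}. admissible (c \<in> s) (v + (B i c - d c))" if "s \<in> patterns" for s
  proof -
    define P where "P r c \<longleftrightarrow> (if c = 4 then r = \<rho> {1} else c \<in> s)" for r c :: nat
    have "\<rho> ` patterns \<subseteq> {1..50}" "4 \<in> {4..50::nat}"
      using \<rho>(2) R(1) by auto
    moreover have "P (\<rho> {1}) 4" "\<not> P (\<rho> {2}) 4"
      using inj_onD[OF \<rho>(1) _ patterns_mem(1,2)] by (auto simp: P_def)
    ultimately obtain S where S: "S \<subseteq> {1..50} \<times> {1..50}" "rigid S" "core \<rho> S"
      and PS: "\<And>i c. i \<in> {1..50} - \<rho> ` patterns \<Longrightarrow> c \<in> {1, 2, 3} \<Longrightarrow> (i, c) \<in> S \<longleftrightarrow> P i c"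
        using rigid_set_exists[OF \<rho>(1), of _ P] by metis
    then obtain f g where fg: "\<And>i j. i \<in> {1..50} \<Longrightarrow> j \<in> {1..50} \<Longrightarrow> admissible ((i, j) \<in> S) (f i + g j + B i j)"
      using B unfolding rigidly_admissible_def by metis
    have "admissible ((\<rho> t, c) \<in> S) ((f (\<rho> t) + B (\<rho> t) 1) + (g c + d c))"
      if "t \<in> patterns" "c \<in> {1, 2, 3}" for t c
      using fg[of "\<rho> t" c] d[OF \<rho>_in[OF that(1)] that(2)] \<rho>_in[OF that(1)] R(1) that(2)
      by (auto simp: algebra_simps)
    then have g: "g c + d c = g 1 + d 1" if "c \<in> {1, 2, 3}" for c
      using core_additive(1)[OF two S(3), of "\<lambda>r. f r + B r 1" "\<lambda>c. g c + d c"] that by blast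
    have "admissible (c \<in> s) ((f i + g 1) + (B i c - d c))" if c: "c \<in> {1, 2, 3}" for c
    proof -
      have "admissible ((i, c) \<in> S) (f i + g c + B i c)"
        using fg[of i c] i c by auto
      moreover have "(i, c) \<in> S \<longleftrightarrow> c \<in> s"
      proof -
        have "i \<in> {1..50} - \<rho> ` patterns"
          using i False \<rho>(2) by blast
        then have "(i, c) \<in> S \<longleftrightarrow> P i c"
          using c by (rule PS)
        also have "c \<noteq> 4"
          using c by auto
        then have "P i c \<longleftrightarrow> c \<in> s"
          by (simp add: P_def)
        finally show ?thesis .
      qed
      moreover have "f i + g c + B i c = (f i + g 1) + (B i c - d c)"
        using g[OF c] d1 by (simp add: algebra_simps)
      ultimately show ?thesis
        by simp
    qed
    then show ?thesis
      by blast
  qed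
  then have "B i 2 - d 2 = B i 1 - d 1" "B i 3 - d 3 = B i 1 - d 1"
    using shattered_imp_constant[OF two, of "\<lambda>c. B i c - d c"] by blast+
  then show ?thesis
    using c d1 by (auto simp: algebra_simps)
qed

text \<open>The transposed argument: three rows act as the test positions, and column
  \<open>j\<close> of \<open>S\<close> runs through all patterns on them. The auxiliary row
  \<open>i3\<close> completes the triple required by \<open>shattered_imp_constant\<close>.\<close>

lemma equal_columns:
  fixes B :: "nat \<Rightarrow> nat \<Rightarrow> 'f::idom"
  assumes two: "(2 :: 'f) \<noteq> 0" and B: "rigidly_admissible B"
    and d: "\<And>i c. i \<in> {1..50} \<Longrightarrow> c \<in> {1, 2, 3} \<Longrightarrow> B i c = B i 1 + d c"
    and i: "i1 \<in> {1..50}" "i2 \<in> {1..50}" and j: "j \<in> {4..50}"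
  shows "B i2 j - B i2 1 = B i1 j - B i1 1"
proof (cases "i1 = i2")
  case False
  obtain i3 :: nat where i3: "i3 \<in> {1..50}" "i3 \<noteq> i1" "i3 \<noteq> i2"
  proof -
    have "card ({1..50} - {i1, i2}) > 0"
      using i False by (subst card_Diff_subset) auto
    then show ?thesis
      using that by (metis Diff_iff card_gt_0_iff ex_in_conv insertCI)
  qed
  define row where "row a = (if a = 1 then i1 else if a = 2 then i2 else i3)" for a :: nat
  have row_in: "row a \<in> {1..50}" for a
    using i i3 by (auto simp: row_def)
  have "card ({1..50} - {i1, i2, i3}) \<ge> 7"
    using i i3 False by (subst card_Diff_subset) auto
  then obtain R where R: "R \<subseteq> {1..50} - {i1, i2, i3}" "card R = 7"
    by (meson obtain_subset_with_card_n)
  obtain \<rho> where \<rho>: "inj_on \<rho> patterns" "\<rho> ` patterns = R"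
    by (rule patterns_bij[OF R(2)])
  have \<rho>_in: "\<rho> s \<in> {1..50} - {i1, i2, i3}" if "s \<in> patterns" for s
    using that \<rho>(2) R(1) by blast
  have row_R: "row a \<in> {1..50} - \<rho> ` patterns" for a
    using row_in[of a] R(1) \<rho>(2) by (auto simp: row_def)
  have d1: "d 1 = 0"
    using d[OF i(1), of 1] by simp
  have "\<exists>v. \<forall>a\<in>{1, 2, 3}. admissible (a \<in> s) (v + (B (row a) j - B (row a) 1))" if "s \<in> patterns" for s
  proof -
    \<comment> \<open>The three rows meet the test columns only in column 1. Being in column 1 but
      not in column 2 will determine their row terms.\<close>
    define P where "P r c \<longleftrightarrow> (if c = j then r = \<rho> {1} \<or> (\<exists>a\<in>s. r = row a) else c = 1)" for r c :: nat
    have P_row: "P (row a) j \<longleftrightarrow> a \<in> s" if "a \<in> {1, 2, 3}" for a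
    proof -
      have "row a = row a' \<longleftrightarrow> a = a'" if "a' \<in> {1, 2, 3}" for a'
        using that \<open>a \<in> {1, 2, 3}\<close> i3 False by (auto simp: row_def)
      moreover have "row a \<noteq> \<rho> {1}"
        using row_R[of a] patterns_mem(1) by (metis DiffD2 imageI)
      moreover have "s \<subseteq> {1, 2, 3}"
        using \<open>s \<in> patterns\<close> by (auto simp: patterns_def)
      ultimately show ?thesis
        unfolding P_def by auto
    qed
    have "\<rho> ` patterns \<subseteq> {1..50}"
      using \<rho>(2) R(1) by auto
    moreover note j
    moreover have "P (\<rho> {1}) j"
      by (simp add: P_def)
    moreover have "\<not> P (\<rho> {2}) j"
    proof -
      have "\<rho> {1} \<noteq> \<rho> {2}"
        using inj_onD[OF \<rho>(1) _ patterns_mem(1,2)] by auto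
      moreover have "\<rho> {2} \<noteq> row a" for a
        using row_R[of a] patterns_mem(2) by (metis DiffD2 imageI)
      ultimately show ?thesis
        by (auto simp: P_def)
    qed
    ultimately obtain S where S: "S \<subseteq> {1..50} \<times> {1..50}" "rigid S" "core \<rho> S"
      and PS: "\<And>i c. i \<in> {1..50} - \<rho> ` patterns \<Longrightarrow> c \<in> {1, 2, 3} \<Longrightarrow> (i, c) \<in> S \<longleftrightarrow> P i c"
      and PSj: "\<And>i. i \<in> {1..50} \<Longrightarrow> (i, j) \<in> S \<longleftrightarrow> P i j"
      using rigid_set_exists[OF \<rho>(1), of _ P] by metis
    then obtain f g where fg: "\<And>i j. i \<in> {1..50} \<Longrightarrow> j \<in> {1..50} \<Longrightarrow> admissible ((i, j) \<in> S) (f i + g j + B i j)"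
      using B unfolding rigidly_admissible_def by metis
    have "admissible ((\<rho> t, c) \<in> S) ((f (\<rho> t) + B (\<rho> t) 1) + (g c + d c))"
      if "t \<in> patterns" "c \<in> {1, 2, 3}" for t c
      using fg[of "\<rho> t" c] d[of "\<rho> t" c] \<rho>_in[OF that(1)] that(2) by (auto simp: algebra_simps)
    then have "g 2 + d 2 = g 1 + d 1"
      using core_additive(1)[OF two S(3), of "\<lambda>r. f r + B r 1" "\<lambda>c. g c + d c" 2] by blast
    then have g: "g 2 + d 2 = g 1"
      using d1 by simp
    have "admissible (a \<in> s) ((g j - g 1) + (B (row a) j - B (row a) 1))" if a: "a \<in> {1, 2, 3}" for a
    proof -
      have "(row a, c) \<in> S \<longleftrightarrow> c = 1" if "c \<in> {1, 2, 3}" for c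
      proof -
        have "c \<noteq> j"
          using that j by auto
        then show ?thesis
          using PS[OF row_R that, of a] by (simp add: P_def)
      qed
      then have "(row a, 1) \<in> S" "(row a, 2) \<notin> S"
        by simp_all
      then have adm: "admissible True (f (row a) + g 1 + B (row a) 1)"
        "admissible False (f (row a) + g 2 + B (row a) 2)"
        using fg[OF row_in, of 1 a] fg[OF row_in, of 2 a] by simp_all
      have eq: "f (row a) + g 2 + B (row a) 2 = f (row a) + g 1 + B (row a) 1"
        using d[OF row_in, of 2 a] g by (simp add: algebra_simps)
      \<comment> \<open>Columns 1 and 2 give row \<open>row a\<close> the same value, once inside
        and once outside \<open>S\<close>. This expresses \<open>f (row a)\<close> through
        \<open>g 1\<close> and \<open>B (row a) 1\<close>.\<close>
      have "f (row a) + g 1 + B (row a) 1 = 0"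
        using adm(1) adm(2)[unfolded eq] by (rule admissible_both)
      then have "f (row a) + g j + B (row a) j = (g j - g 1) + (B (row a) j - B (row a) 1)"
        by (simp add: algebra_simps eq_neg_iff_add_eq_0)
      moreover have "admissible (a \<in> s) (f (row a) + g j + B (row a) j)"
        using fg[OF row_in, of j a] PSj[OF row_in, of a] P_row[OF a] j by simp
      ultimately show ?thesis
        by (simp only:)
    qed
    then show ?thesis
      by blast
  qed
  then have "B (row 2) j - B (row 2) 1 = B (row 1) j - B (row 1) 1"
    using shattered_imp_constant(1)[OF two, of "\<lambda>a. B (row a) j - B (row a) 1"] by blast
  then show ?thesis
    by (simp add: row_def)
qed simp

lemma rigidly_admissible_additive:
  fixes B :: "nat \<Rightarrow> nat \<Rightarrow> 'f::idom"
  assumes two: "(2 :: 'f) \<noteq> 0" and B: "rigidly_admissible B"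
    and ij: "i \<in> {1..50}" "j \<in> {1..50}"
  shows "B i j = B i 1 + (B 1 j - B 1 1)"
proof -
  obtain R d where R: "R \<subseteq> {1..50}" "card R = 7"
    "\<And>i c. i \<in> R \<Longrightarrow> c \<in> {1, 2, 3} \<Longrightarrow> B i c = B i 1 + d c"
    using equal_rows[OF B] by blast
  note d = equal_rows_extend[OF two B R]
  show ?thesis
  proof (cases "j \<in> {1, 2, 3}")
    case True
    have "B i j = B i 1 + d j" "B 1 j = B 1 1 + d j"
      by (rule d; use True ij in simp)+
    then show ?thesis
      by simp
  next
    case False
    then have "j \<in> {4..50}"
      using ij(2) by auto
    then have "B i j - B i 1 = B 1 j - B 1 1"
      using equal_columns[OF two B d, of 1 i j] ij by simp
    then show ?thesis
      by (simp add: algebra_simps)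
  qed
qed

lemma rigid_exists: "\<exists>S. S \<subseteq> {1..50} \<times> {1..50} \<and> rigid S"
proof -
  obtain \<rho> where \<rho>: "inj_on \<rho> patterns" "\<rho> ` patterns = {44..50::nat}"
    by (rule patterns_bij[of "{44..50}"]) auto
  then have "\<rho> ` patterns \<subseteq> {1..50}" "\<rho> {2} \<noteq> \<rho> {1}"
    using inj_onD[OF \<rho>(1) _ patterns_mem(1,2)] by auto
  then show ?thesis
    using rigid_set_exists[OF \<rho>(1), of 4 "\<lambda>i c. i = \<rho> {1}"] by auto
qed

section \<open>The quadratic Green--Sanders set\<close>

text \<open>Grouped for \<open>u\<close>, \<open>v\<close>, \<open>z\<close> standing for
  \<open>x i\<close>, \<open>y j\<close>, \<open>z S\<close>: the first summand is independent of
  \<open>j\<close>, the second of \<open>i\<close>, the third of \<open>S\<close>.\<close>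

lemma quad_form_add3:
  fixes M :: "'f::comm_ring_1 ^ 'n ^ 'n"
  shows "quad_form M (u + v + z) =
    (quad_form M u + scalar_product u (M *v z) + scalar_product z (M *v u) + quad_form M z)
    + (quad_form M v + scalar_product v (M *v z) + scalar_product z (M *v v))
    + (scalar_product u (M *v v) + scalar_product v (M *v u))"
proof -
  have left: "scalar_product (a + b) c = scalar_product a c + scalar_product b c"
    for a b c :: "'f ^ 'n"
    by (simp add: scalar_product_def distrib_right sum.distrib)
  have right: "scalar_product c (a + b) = scalar_product c a + scalar_product c b"
    for a b c :: "'f ^ 'n"
    by (simp add: scalar_product_def distrib_left sum.distrib)
  show ?thesis
    by (simp only: quad_form_def matrix_vector_right_distrib left right ac_simps)
qed

lemma QGS_not_shattered:
  fixes M :: "nat \<Rightarrow> 'f::{idom, finite} ^ 'n ^ 'n"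
  assumes two: "(2 :: 'f) \<noteq> 0" and "50 \<le> k"
  shows "\<not> vc2_dim_at_least (QGS M) k"
proof
  assume "vc2_dim_at_least (QGS M) k"
  then obtain x y z where xyz: "\<forall>S. S \<subseteq> {1..k} \<times> {1..k} \<longrightarrow>
      (\<forall>i\<in>{1..k}. \<forall>j\<in>{1..k}. x i + y j + z S \<in> QGS M \<longleftrightarrow> (i, j) \<in> S)"
    unfolding vc2_dim_at_least_def by (elim exE)
  have "{1..50} \<subseteq> {1..k}"
    using \<open>50 \<le> k\<close> by simp
  then have shattered: "x i + y j + z S \<in> QGS M \<longleftrightarrow> (i, j) \<in> S"
    if "S \<subseteq> {1..50} \<times> {1..50}" "i \<in> {1..50}" "j \<in> {1..50}" for S i j
    using xyz[rule_format, of S i j] that by (meson Sigma_mono subset_trans subsetD)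
  define f where "f l S i = quad_form (M l) (x i) + scalar_product (x i) (M l *v z S)
      + scalar_product (z S) (M l *v x i) + quad_form (M l) (z S)" for l S i
  define g where "g l S j = quad_form (M l) (y j) + scalar_product (y j) (M l *v z S)
      + scalar_product (z S) (M l *v y j)" for l S j
  define B where "B l i j = scalar_product (x i) (M l *v y j) + scalar_product (y j) (M l *v x i)" for l i j
  have Q: "quad_form (M l) (x i + y j + z S) = f l S i + g l S j + B l i j" for l i j S
    unfolding f_def g_def B_def by (rule quad_form_add3)
  have vanish: "quad_form (M l) (x i + y j + z S) = 0"
    if "l \<in> {1..CARD('n)}" "S \<subseteq> {1..50} \<times> {1..50}" "rigid S" "i \<in> {1..50}" "j \<in> {1..50}" for l S i j
    using that
  \<comment> \<open>Additivity of \<open>B l\<close> draws on all rigid sets at once, so the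
    induction hypothesis must cover every rigid \<open>S\<close> and not just the given one.\<close>
  proof (induction l arbitrary: S i j rule: less_induct)
    case (less l)
    have adm: "admissible ((i, j) \<in> S) (f l S i + g l S j + B l i j)"
      if S: "S \<subseteq> {1..50} \<times> {1..50}" "rigid S" and ij: "i \<in> {1..50}" "j \<in> {1..50}" for S i j
    proof -
      let ?w = "x i + y j + z S"
      have below: "quad_form (M m) ?w = 0" if "m \<in> {1..<l}" for m
        using less.IH[OF _ _ S ij, of m] that less.prems(1) by simp
      show ?thesis
      proof (cases "(i, j) \<in> S")
        case True
        then obtain m where m: "m \<in> {1..CARD('n)}" "\<forall>m'\<in>{1..<m}. quad_form (M m') ?w = 0"
          "quad_form (M m) ?w = 1"
          using shattered[OF S(1) ij] unfolding QGS_def by blast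
        \<comment> \<open>The witness \<open>m\<close> of membership is not below \<open>l\<close>,
          where the forms vanish. So either \<open>m = l\<close> with value 1, or
          \<open>l < m\<close> with value 0.\<close>
        have "\<not> m < l"
          using below[of m] m(1,3) by force
        then have "quad_form (M l) ?w = 0 \<or> quad_form (M l) ?w = 1"
          using m less.prems(1) by (cases "m = l") auto
        then show ?thesis
          using True by (simp add: admissible_def Q)
      next
        case False
        then have "quad_form (M l) ?w \<noteq> 1"
          using shattered[OF S(1) ij] below less.prems(1) unfolding QGS_def by blast
        then show ?thesis
          using False by (simp add: admissible_def Q)
      qed
    qed
    then have "rigidly_admissible (B l)"
      unfolding rigidly_admissible_def by blast
    note B = rigidly_admissible_additive[OF two this]
    \<comment> \<open>The additive \<open>B l\<close> is split between the row and the column term,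
      which puts the value into the shape of \<open>rigid_additive_zero\<close>.\<close>
    have "admissible ((i, j) \<in> S) ((f l S i + B l i 1) + (g l S j + (B l 1 j - B l 1 1)))"
      if "i \<in> {1..50}" "j \<in> {1..50}" for i j
      using adm[OF less.prems(2,3) that] B[OF that] by (simp add: algebra_simps)
    then have "(f l S i + B l i 1) + (g l S j + (B l 1 j - B l 1 1)) = 0"
      using rigid_additive_zero[OF two less.prems(3), of "\<lambda>i. f l S i + B l i 1"
          "\<lambda>j. g l S j + (B l 1 j - B l 1 1)" i j] less.prems(4,5) by blast
    then have "f l S i + g l S j + B l i j = 0"
      unfolding B[OF less.prems(4,5)] by (simp only: ac_simps)
    then show ?case
      by (simp only: Q)
  qed
  obtain S where S: "S \<subseteq> {1..50} \<times> {1..50}" "rigid S"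
    using rigid_exists by blast
  then obtain i j where ij: "i \<in> {1..50}" "j \<in> {1..50}" "(i, j) \<in> S"
    unfolding rigid_def core_def using patterns_mem(1) by blast
  then have "x i + y j + z S \<in> QGS M"
    using shattered[OF S(1) ij(1,2)] by blast
  then obtain l where "l \<in> {1..CARD('n)}" "quad_form (M l) (x i + y j + z S) = 1"
    unfolding QGS_def by blast
  then show False
    using vanish[OF _ S ij(1,2), of l] by simp
qed

theorem theorem1p7:
  fixes M :: "nat \<Rightarrow> 'p::prime_card mod_ring ^ 'n ^ 'n"
  assumes "CARD('p) > 2"
    and "\<And>i. i \<in> {1..CARD('n)} \<Longrightarrow> transpose (M i) = M i"
    and "\<And>c :: nat \<Rightarrow> 'p mod_ring. \<exists>i\<in>{1..CARD('n)}. c i \<noteq> 0 \<Longrightarrow> rank (lin_comb c M) = CARD('n)"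
  shows "vc2_dim (QGS M) \<le> bipartite_ramsey 5 3 3"
proof -
  have two: "(2 :: 'p mod_ring) \<noteq> 0"
  proof
    assume "(2 :: 'p mod_ring) = 0"
    then have "of_nat 2 = (0 :: 'p mod_ring)"
      by simp
    then have "CARD('p) dvd 2"
      by (rule of_nat_0_mod_ring_dvd)
    then have "CARD('p) \<le> 2"
      by (rule dvd_imp_le) simp
    with assms(1) show False
      by simp
  qed
  have bound: "k < 50" if "vc2_dim_at_least (QGS M) k" for k
    using QGS_not_shattered[OF two, of k M] that by linarith
  then have "{k. vc2_dim_at_least (QGS M) k} \<subseteq> {..<50}"
    by blast
  then have "finite {k. vc2_dim_at_least (QGS M) k}"
    by (rule finite_subset) simp
  \<comment> \<open>With finiteness, this makes \<open>Max\<close> an attained value, to which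
    \<open>bound\<close> applies.\<close>
  moreover have "vc2_dim_at_least (QGS M) 0"
    by (simp add: vc2_dim_at_least_def)
  ultimately have "vc2_dim_at_least (QGS M) (vc2_dim (QGS M))"
    unfolding vc2_dim_def using Max_in[of "{k. vc2_dim_at_least (QGS M) k}"] by blast
  then have "vc2_dim (QGS M) < 50"
    by (rule bound)
  then show ?thesis
    using bipartite_ramsey_5_3_3_gt by linarith
qed

end
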